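(* Let $\{Z_n\}_{n\ge 0}$ be a branching process in an i.i.d. random environment, with $X=\ln m_0$, $\mu=\mathbb{E}X$, $\sigma^2=\mathbb{E}(X-\mu)^2$ as in the context, such that almost surely every individual has at least one child and $0<\sigma^2<\infty$. Assume that there exist real constants $H_1<H_2$ such that $H_1\le X-\mu\le H_2$ almost surely. Let $n_0\ge0$ and $n\ge1$ be integers, let $$\delta_n\in\left[2\exp\left\{-\tfrac n2(H_2-H_1)^2\right\},\,1\right]\qquad\text{and}\qquad \Delta_n=(H_2-H_1)\sqrt{\tfrac2n\ln(2/\delta_n)}.$$ Then $[1,A_n]$, with $$A_n=Z_{n_0}\exp\{n(\mu+\Delta_n)\},$$ is a $1-\delta_n$ confidence interval for $Z_{n_0+n}$, i.e. $\mathbb{P}(1\le Z_{n_0+n}\le A_n)\ge1-\delta_n$.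
   Context: Branching process in a random environment: $\xi=(\xi_0,\xi_1,\dots)$ is a sequence of i.i.d. random variables (the environment). Each value of $\xi_n$ determines a probability distribution $p(\xi_n)=\{p_n(i): i\in\mathbb{N}\}$ on $\mathbb{N}=\{0,1,2,\dots\}$ (the offspring law at generation $n$). The process is defined by $Z_0=1$ and $Z_{n+1}=\sum_{i=1}^{Z_n}N_{n,i}$ for $n\ge 0$, where, conditionally on $\xi$, the variables $\{N_{n,i}: n\ge0,i\ge1\}$ are independent and, for each $n$, the $N_{n,i}$ $(i\ge1)$ have common law $p(\xi_n)$. $\mathbb{P}$ is the total (annealed) law, i.e. $\mathbb{P}(dx,d\xi)=\mathbb{P}_\xi(dx)\tau(d\xi)$ with $\mathbb{P}_\xi$ the conditional law given $\xi$ and $\tau$ the law of $\xi$; $\mathbb{E}$ is the corresponding expectation. Put $m_n=\sum_{i\ge0} i\,p_n(i)$ (conditional mean offspring number at generation $n$ given $\xi$), $X=\ln m_0$, $\mu=\mathbb{E}X$, $\sigma^2=\mathbb{E}(X-\mu)^2$, $\sigma>0$. Standing assumption: $p_0(0)=0$ almost surely (the probability of having no children is zero) and $0<\sigma^2<\infty$; hence $Z_n\ge1$ a.s. for all $n$. *)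

theory Defs
  imports "HOL-Probability.Probability"
begin

text \<open>
  The population does not depend on \<open>N n 0\<close>: individuals of generation \<open>n\<close> are numbered from 1.
\<close>

primrec population :: "(nat \<Rightarrow> nat \<Rightarrow> 'a \<Rightarrow> nat) \<Rightarrow> nat \<Rightarrow> 'a \<Rightarrow> nat" where
  "population N 0 \<omega> = 1"
| "population N (Suc n) \<omega> = (\<Sum>i = 1..population N n \<omega>. N n i \<omega>)"

text \<open>Meaningful only if the series converges.\<close>

definition offspring_mean :: "nat pmf \<Rightarrow> real" where
  "offspring_mean q = (\<Sum>i. real i * pmf q i)"

definition env_algebra :: "'a measure \<Rightarrow> 'e measure \<Rightarrow> (nat \<Rightarrow> 'a \<Rightarrow> 'e) \<Rightarrow> 'a measure" where
  "env_algebra M E \<xi> =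
     vimage_algebra (space M) (\<lambda>\<omega> n. \<xi> n \<omega>) (\<Pi>\<^sub>M n\<in>(UNIV :: nat set). E)"

text \<open>
  A branching process in an i.i.d. random environment, on an arbitrary probability space \<open>M\<close>
  carrying the annealed law; the environment takes values in the measurable space \<open>E\<close>.
  Assumption \<open>offspring_cond\<close> says that, given the whole environment sequence, the variables
  \<open>N n i\<close> with \<open>i \<ge> 1\<close> are independent and \<open>N n i\<close> has law \<open>p (\<xi> n)\<close>.
\<close>

locale bpre = prob_space M
  for M :: "'a measure" and E :: "'e measure"
    and \<xi> :: "nat \<Rightarrow> 'a \<Rightarrow> 'e"
    and p :: "'e \<Rightarrow> nat pmf"
    and N :: "nat \<Rightarrow> nat \<Rightarrow> 'a \<Rightarrow> nat" +
  assumes env_indep: "indep_vars (\<lambda>_. E) \<xi> UNIV"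
    and env_ident: "\<And>n. distr M E (\<xi> n) = distr M E (\<xi> 0)"
    and offspring_kernel: "(\<lambda>e. measure_pmf (p e)) \<in> E \<rightarrow>\<^sub>M prob_algebra (count_space UNIV)"
    and offspring_measurable: "\<And>n i. i \<ge> 1 \<Longrightarrow> N n i \<in> M \<rightarrow>\<^sub>M count_space UNIV"
    and offspring_cond:
      "\<And>J B. finite J \<Longrightarrow> J \<subseteq> UNIV \<times> {1..} \<Longrightarrow>
         AE \<omega> in M.
           real_cond_exp M (env_algebra M E \<xi>)
             (indicator {\<omega> \<in> space M. \<forall>(n, i) \<in> J. N n i \<omega> \<in> B n i}) \<omega>
           = (\<Prod>(n, i) \<in> J. measure_pmf.prob (p (\<xi> n \<omega>)) (B n i))"

end

theory Submission
  imports Defs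
begin

text \<open>
  Given the environment, \<open>Z (l + k)\<close> divided by \<open>Z l\<close> and by the product of the conditional
  means of the generations \<open>l, \<dots>, l + k - 1\<close> has expectation at most 1. Markov's inequality
  controls this ratio and Hoeffding's inequality controls the logarithm of the product. Each
  exceeds its mean behaviour by the factor \<open>exp (n * \<Delta> / 2)\<close> with probability at most
  \<open>\<delta> / 2\<close>; the lower bound on \<open>\<delta>\<close> is what makes this true of the Markov part.
\<close>

context bpre
begin

section \<open>Measurability of the environment and of its offspring laws\<close>

lemma env_random_variable [measurable]: "\<xi> n \<in> M \<rightarrow>\<^sub>M E"
  using env_indep by (auto simp: indep_vars_def)

lemma subalgebra_env: "subalgebra M (env_algebra M E \<xi>)"
proof -
  have "(\<lambda>\<omega> n. \<xi> n \<omega>) \<in> M \<rightarrow>\<^sub>M (\<Pi>\<^sub>M n\<in>UNIV. E)"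
    by (intro measurable_PiM_single') (auto intro: measurable_space[OF env_random_variable])
  then show ?thesis
    unfolding subalgebra_def env_algebra_def
    by (simp add: sets_image_in_sets)
qed

lemma env_coordinate [measurable]: "\<xi> n \<in> env_algebra M E \<xi> \<rightarrow>\<^sub>M E"
proof -
  have "(\<lambda>\<omega> n. \<xi> n \<omega>) \<in> space M \<rightarrow> space (\<Pi>\<^sub>M n\<in>UNIV. E)"
    by (auto simp: space_PiM intro: measurable_space[OF env_random_variable])
  then have "(\<lambda>\<omega> n. \<xi> n \<omega>) \<in> env_algebra M E \<xi> \<rightarrow>\<^sub>M (\<Pi>\<^sub>M n\<in>UNIV. E)"
    unfolding env_algebra_def by (rule measurable_vimage_algebra1)
  then show ?thesis
    by (rule measurable_compose[OF _ measurable_component_singleton[OF UNIV_I]])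
qed

sublocale env: finite_measure_subalgebra M "env_algebra M E \<xi>"
  by unfold_locales (rule subalgebra_env)

lemma measurable_law [measurable]: "(\<lambda>e. measure_pmf (p e)) \<in> E \<rightarrow>\<^sub>M subprob_algebra (count_space UNIV)"
  by (rule measurable_prob_algebraD[OF offspring_kernel])

lemma measurable_pmf_law [measurable]: "(\<lambda>e. pmf (p e) c) \<in> borel_measurable E"
  unfolding pmf.rep_eq by measurable

lemma measurable_offspring_mean [measurable]: "(\<lambda>e. offspring_mean (p e)) \<in> borel_measurable E"
  unfolding offspring_mean_def by measurable

section \<open>Cylinder events of offspring numbers and their conditional probabilities\<close>

definition cyl :: "(nat \<times> nat) set \<Rightarrow> (nat \<Rightarrow> nat \<Rightarrow> nat) \<Rightarrow> 'a set" where
  "cyl J v = {\<omega> \<in> space M. \<forall>(n, i) \<in> J. N n i \<omega> = v n i}"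

text \<open>This is the conditional probability of \<open>cyl J v\<close> given the environment.
  Values in \<open>ennreal\<close> let all later integrals be manipulated without integrability
  conditions.\<close>

definition weight :: "(nat \<times> nat) set \<Rightarrow> (nat \<Rightarrow> nat \<Rightarrow> nat) \<Rightarrow> 'a \<Rightarrow> ennreal" where
  "weight J v \<omega> = (\<Prod>(n, i) \<in> J. ennreal (pmf (p (\<xi> n \<omega>)) (v n i)))"

lemma cyl_sets:
  assumes "finite J" "J \<subseteq> UNIV \<times> {1..}"
  shows "cyl J v \<in> sets M"
proof -
  have m: "{\<omega> \<in> space M. N n i \<omega> = v n i} \<in> sets M" if "(n, i) \<in> J" for n i
  proof -
    have [measurable]: "N n i \<in> M \<rightarrow>\<^sub>M count_space UNIV"
      using that assms(2) by (intro offspring_measurable) auto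
    show ?thesis by measurable
  qed
  show ?thesis
    unfolding cyl_def case_prod_beta using assms m by (intro sets.sets_Collect_finite_All) auto
qed

lemma weight_measurable [measurable]: "weight J v \<in> borel_measurable (env_algebra M E \<xi>)"
  unfolding weight_def case_prod_beta by measurable

text \<open>Integrated form of \<open>offspring_cond\<close> for point values: testing against
  nonnegative environment-measurable \<open>f\<close> replaces an almost sure statement about
  \<open>real_cond_exp\<close> by an identity that can be summed and iterated.\<close>

lemma nn_integral_cyl:
  assumes J: "finite J" "J \<subseteq> UNIV \<times> {1..}"
    and f [measurable]: "f \<in> borel_measurable (env_algebra M E \<xi>)"
  shows "(\<integral>\<^sup>+\<omega>. f \<omega> * indicator (cyl J v) \<omega> \<partial>M) = (\<integral>\<^sup>+\<omega>. f \<omega> * weight J v \<omega> \<partial>M)"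
proof -
  let ?F = "env_algebra M E \<xi>" and ?g = "indicator (cyl J v) :: 'a \<Rightarrow> ennreal"
  have [measurable]: "cyl J v \<in> sets M"
    by (rule cyl_sets[OF J])
  have sub: "g \<in> borel_measurable M" if "g \<in> borel_measurable ?F" for g :: "'a \<Rightarrow> ennreal"
    using measurable_from_subalg[OF subalgebra_env that] .
  have one: "(\<lambda>_. 1 :: ennreal) \<in> borel_measurable ?F"
    by simp
  \<comment> \<open>\<open>real_cond_exp\<close> is a difference of two \<open>nn_cond_exp\<close>
    passed through \<open>enn2real\<close>. To recover the first one, it must be finite almost
    everywhere (\<open>enn2real\<close> sends infinity to 0) and the negative part must
    vanish.\<close>
  have "(\<integral>\<^sup>+\<omega>. nn_cond_exp M ?F ?g \<omega> \<partial>M) = emeasure M (cyl J v)"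
    using env.nn_cond_exp_intg[OF one, of ?g] by simp
  then have fin: "AE \<omega> in M. nn_cond_exp M ?F ?g \<omega> \<noteq> \<infinity>"
    by (intro nn_integral_PInf_AE) (auto intro!: sub borel_measurable_nn_cond_exp)
  have "(\<integral>\<^sup>+\<omega>. nn_cond_exp M ?F (\<lambda>_. 0) \<omega> \<partial>M) = 0"
    using env.nn_cond_exp_intg[OF one, of "\<lambda>_. 0"] by simp
  then have zero: "AE \<omega> in M. nn_cond_exp M ?F (\<lambda>_. 0) \<omega> = 0"
    by (subst (asm) nn_integral_0_iff_AE) (auto intro!: sub borel_measurable_nn_cond_exp)
  have *: "(\<lambda>x. ennreal (indicator (cyl J v) x)) = ?g" "(\<lambda>x. ennreal (- indicator (cyl J v) x)) = (\<lambda>_. 0)"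
    by (auto simp: indicator_def ennreal_neg)
  have "AE \<omega> in M. real_cond_exp M ?F (indicator (cyl J v)) \<omega>
      = (\<Prod>(n, i) \<in> J. pmf (p (\<xi> n \<omega>)) (v n i))"
    using offspring_cond[OF J, of "\<lambda>n i. {v n i}"] by (simp add: cyl_def pmf.rep_eq case_prod_beta)
  with fin zero have ae: "AE \<omega> in M. nn_cond_exp M ?F ?g \<omega> = weight J v \<omega>"
  proof eventually_elim
    case (elim \<omega>)
    then have "enn2real (nn_cond_exp M ?F ?g \<omega>) = (\<Prod>(n, i) \<in> J. pmf (p (\<xi> n \<omega>)) (v n i))"
      by (simp add: real_cond_exp_def *)
    moreover have "nn_cond_exp M ?F ?g \<omega> = ennreal (enn2real (nn_cond_exp M ?F ?g \<omega>))"
      using elim by (simp add: less_top)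
    ultimately show ?case
      by (simp add: weight_def prod_ennreal case_prod_beta)
  qed
  have "(\<integral>\<^sup>+\<omega>. f \<omega> * ?g \<omega> \<partial>M) = (\<integral>\<^sup>+\<omega>. f \<omega> * nn_cond_exp M ?F ?g \<omega> \<partial>M)"
    by (rule env.nn_cond_exp_intg[symmetric]) auto
  also have "\<dots> = (\<integral>\<^sup>+\<omega>. f \<omega> * weight J v \<omega> \<partial>M)"
    by (rule nn_integral_cong_AE) (use ae in auto)
  finally show ?thesis .
qed

section \<open>Events of the past and their closure properties\<close>

text \<open>
  Given the environment, \<open>G\<close> is independent of the offspring numbers from generation \<open>l\<close>
  on. The quantification over \<open>f\<close> lets weights of earlier cylinders be absorbed into \<open>f\<close>.
\<close>

definition past :: "nat \<Rightarrow> 'a set \<Rightarrow> bool" where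
  "past l G \<longleftrightarrow> G \<in> sets M \<and>
     (\<forall>f J v. f \<in> borel_measurable (env_algebra M E \<xi>) \<longrightarrow> finite J \<longrightarrow> J \<subseteq> {l..} \<times> {1..} \<longrightarrow>
       (\<integral>\<^sup>+\<omega>. f \<omega> * indicator (cyl J v) \<omega> * indicator G \<omega> \<partial>M)
         = (\<integral>\<^sup>+\<omega>. f \<omega> * weight J v \<omega> * indicator G \<omega> \<partial>M))"

lemma pastD:
  assumes "past l G"
  shows "G \<in> sets M"
    and "f \<in> borel_measurable (env_algebra M E \<xi>) \<Longrightarrow> finite J \<Longrightarrow> J \<subseteq> {l..} \<times> {1..} \<Longrightarrow>
      (\<integral>\<^sup>+\<omega>. f \<omega> * indicator (cyl J v) \<omega> * indicator G \<omega> \<partial>M)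
        = (\<integral>\<^sup>+\<omega>. f \<omega> * weight J v \<omega> * indicator G \<omega> \<partial>M)"
  using assms by (auto simp: past_def)

lemma past_empty: "past l {}"
  by (simp add: past_def)

lemma past_space: "past l (space M)"
  unfolding past_def
proof (intro conjI allI impI)
  fix f :: "'a \<Rightarrow> ennreal" and J :: "(nat \<times> nat) set" and v
  assume *: "f \<in> borel_measurable (env_algebra M E \<xi>)" "finite J" "J \<subseteq> {l..} \<times> {1..}"
  have "(\<integral>\<^sup>+\<omega>. f \<omega> * indicator (cyl J v) \<omega> * indicator (space M) \<omega> \<partial>M) = (\<integral>\<^sup>+\<omega>. f \<omega> * indicator (cyl J v) \<omega> \<partial>M)"
    by (intro nn_integral_cong) auto
  also have "\<dots> = (\<integral>\<^sup>+\<omega>. f \<omega> * weight J v \<omega> \<partial>M)"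
    using * by (intro nn_integral_cyl) auto
  also have "\<dots> = (\<integral>\<^sup>+\<omega>. f \<omega> * weight J v \<omega> * indicator (space M) \<omega> \<partial>M)"
    by (intro nn_integral_cong) auto
  finally show "(\<integral>\<^sup>+\<omega>. f \<omega> * indicator (cyl J v) \<omega> * indicator (space M) \<omega> \<partial>M)
    = (\<integral>\<^sup>+\<omega>. f \<omega> * weight J v \<omega> * indicator (space M) \<omega> \<partial>M)" .
qed simp

text \<open>Integrating \<open>h\<close> over a set is the measure with density \<open>h\<close>, so
  both sides of the identity in \<open>past\<close> are countably additive in the event.\<close>

lemma past_UN:
  assumes I: "countable I" and disj: "disjoint_family_on A I" and A: "\<And>k. k \<in> I \<Longrightarrow> past l (A k)"
  shows "past l (\<Union>k\<in>I. A k)"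
  unfolding past_def
proof (intro conjI allI impI)
  have AM: "\<And>k. k \<in> I \<Longrightarrow> A k \<in> sets M"
    using A pastD(1) by blast
  show UM: "(\<Union>k\<in>I. A k) \<in> sets M"
    using I AM by (intro sets.countable_UN'') auto
  fix f :: "'a \<Rightarrow> ennreal" and J :: "(nat \<times> nat) set" and v
  assume *: "f \<in> borel_measurable (env_algebra M E \<xi>)" "finite J" "J \<subseteq> {l..} \<times> {1..}"
  have cyl [measurable]: "cyl J v \<in> sets M"
    using * by (intro cyl_sets) auto
  have fm [measurable]: "f \<in> borel_measurable M" "weight J v \<in> borel_measurable M"
    by (rule measurable_from_subalg[OF subalgebra_env], use * in measurable)+
  have split: "(\<integral>\<^sup>+\<omega>. h \<omega> * indicator (\<Union>k\<in>I. A k) \<omega> \<partial>M)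
      = (\<integral>\<^sup>+k. (\<integral>\<^sup>+\<omega>. h \<omega> * indicator (A k) \<omega> \<partial>M) \<partial>count_space I)"
    if h: "h \<in> borel_measurable M" for h :: "'a \<Rightarrow> ennreal"
  proof -
    have "(\<integral>\<^sup>+\<omega>. h \<omega> * indicator (\<Union>k\<in>I. A k) \<omega> \<partial>M) = emeasure (density M h) (\<Union>k\<in>I. A k)"
      using h UM by (simp add: emeasure_density)
    also have "\<dots> = (\<integral>\<^sup>+k. emeasure (density M h) (A k) \<partial>count_space I)"
      using AM I disj by (intro emeasure_UN_countable) auto
    also have "\<dots> = (\<integral>\<^sup>+k. (\<integral>\<^sup>+\<omega>. h \<omega> * indicator (A k) \<omega> \<partial>M) \<partial>count_space I)"
      using h AM by (intro nn_integral_cong) (simp add: emeasure_density)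
    finally show ?thesis .
  qed
  show "(\<integral>\<^sup>+\<omega>. f \<omega> * indicator (cyl J v) \<omega> * indicator (\<Union>k\<in>I. A k) \<omega> \<partial>M)
    = (\<integral>\<^sup>+\<omega>. f \<omega> * weight J v \<omega> * indicator (\<Union>k\<in>I. A k) \<omega> \<partial>M)"
    using * by (simp add: split pastD(2)[OF A] cong: nn_integral_cong_simp)
qed

text \<open>The hypothesis on \<open>G\<close> is used twice. First the cylinder of generation
  \<open>l\<close> and the later one, joined, are both turned into weights; then, with the later
  weight absorbed into \<open>f\<close>, the weight of generation \<open>l\<close> is turned back
  into its indicator.\<close>

lemma past_cyl:
  assumes G: "past l G" and I: "finite I" "I \<subseteq> {1..}"
  shows "past (Suc l) (G \<inter> cyl ({l} \<times> I) v)"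
  unfolding past_def
proof (intro conjI allI impI)
  show "G \<inter> cyl ({l} \<times> I) v \<in> sets M"
    using I by (intro sets.Int pastD(1)[OF G] cyl_sets) auto
  fix f :: "'a \<Rightarrow> ennreal" and J :: "(nat \<times> nat) set" and w
  assume *: "f \<in> borel_measurable (env_algebra M E \<xi>)" "finite J" "J \<subseteq> {Suc l..} \<times> {1..}"
  note [measurable] = *(1)
  \<comment> \<open>The two cylinders concern disjoint sets of generations, so a single function can
    prescribe \<open>v\<close> in generation \<open>l\<close> and \<open>w\<close>
    afterwards.\<close>
  define u where "u = w(l := v l)"
  let ?K = "{l} \<times> I"
  have K: "finite ?K" "?K \<subseteq> {l..} \<times> {1..}" "?K \<inter> J = {}"
    using I * by auto
  have cyl: "indicator (cyl J w) \<omega> * indicator (G \<inter> cyl ?K v) \<omega> = indicator (cyl (?K \<union> J) u) \<omega> * (indicator G \<omega> :: ennreal)" for \<omega>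
  proof -
    have "cyl J u = cyl J w"
      using *(3) unfolding cyl_def by (intro Collect_cong conj_cong refl ball_cong) (auto simp: u_def)
    moreover have "cyl ?K u = cyl ?K v"
      by (auto simp: cyl_def u_def)
    moreover have "cyl (?K \<union> J) u = cyl ?K u \<inter> cyl J u"
      by (auto simp: cyl_def)
    ultimately show ?thesis
      by (auto simp: indicator_def)
  qed
  have wJ: "weight J u \<omega> = weight J w \<omega>" for \<omega>
    unfolding weight_def using *(3) by (intro prod.cong) (auto simp: u_def)
  have wK: "weight ?K u \<omega> = weight ?K v \<omega>" for \<omega>
    unfolding weight_def by (intro prod.cong) (auto simp: u_def)
  have weight: "weight (?K \<union> J) u \<omega> = weight ?K v \<omega> * weight J w \<omega>" for \<omega>
  proof -
    have "weight (?K \<union> J) u \<omega> = weight ?K u \<omega> * weight J u \<omega>"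
      using *(2) K unfolding weight_def by (intro prod.union_disjoint) auto
    then show ?thesis by (simp only: wK wJ)
  qed
  have "(\<integral>\<^sup>+\<omega>. f \<omega> * indicator (cyl J w) \<omega> * indicator (G \<inter> cyl ?K v) \<omega> \<partial>M)
      = (\<integral>\<^sup>+\<omega>. f \<omega> * indicator (cyl (?K \<union> J) u) \<omega> * indicator G \<omega> \<partial>M)"
    by (simp only: mult.assoc cyl)
  also have "\<dots> = (\<integral>\<^sup>+\<omega>. f \<omega> * weight (?K \<union> J) u \<omega> * indicator G \<omega> \<partial>M)"
    using * K by (intro pastD(2)[OF G]) auto
  also have "\<dots> = (\<integral>\<^sup>+\<omega>. (f \<omega> * weight J w \<omega>) * weight ?K v \<omega> * indicator G \<omega> \<partial>M)"
    by (simp only: weight mult_ac)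
  also have "\<dots> = (\<integral>\<^sup>+\<omega>. (f \<omega> * weight J w \<omega>) * indicator (cyl ?K v) \<omega> * indicator G \<omega> \<partial>M)"
    using K by (intro pastD(2)[OF G, symmetric]) auto
  also have "\<dots> = (\<integral>\<^sup>+\<omega>. f \<omega> * weight J w \<omega> * indicator (G \<inter> cyl ?K v) \<omega> \<partial>M)"
    by (simp add: indicator_inter_arith mult_ac)
  finally show "(\<integral>\<^sup>+\<omega>. f \<omega> * indicator (cyl J w) \<omega> * indicator (G \<inter> cyl ?K v) \<omega> \<partial>M)
    = (\<integral>\<^sup>+\<omega>. f \<omega> * weight J w \<omega> * indicator (G \<inter> cyl ?K v) \<omega> \<partial>M)" .
qed

section \<open>Population sizes as events of the past\<close>

definition level :: "nat \<Rightarrow> nat \<Rightarrow> 'a set" where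
  "level l a = {\<omega> \<in> space M. population N l \<omega> = a}"

text \<open>The next population size is settled by the current size \<open>a\<close> and the
  offspring numbers of \<open>a\<close> individuals, so the event is a countable disjoint union of
  cylinders cut with current levels. A general \<open>G\<close> allows an earlier population size to
  be fixed as well.\<close>

lemma past_population_Suc:
  assumes G: "\<And>a. past l (G \<inter> level l a)"
  shows "past (Suc l) (G \<inter> level (Suc l) b)"
proof -
  \<comment> \<open>Numbers with sum \<open>b\<close> are at most \<open>b\<close>, so each
    \<open>a\<close> admits finitely many \<open>v\<close> and \<open>I\<close> is countable. Taking
    \<open>v\<close> extensional makes it determined by its values on \<open>{1..a}\<close>, hence
    distinct indices give disjoint events.\<close>
  define I where "I = (SIGMA a:(UNIV :: nat set). {v \<in> {1..a} \<rightarrow>\<^sub>E {..b}. sum v {1..a} = b})"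
  define A where "A = (\<lambda>(a, v). (G \<inter> level l a) \<inter> cyl ({l} \<times> {1..a}) (\<lambda>_. v))"
  have "G \<inter> level (Suc l) b = (\<Union>k\<in>I. A k)"
  proof (intro equalityI subsetI)
    fix \<omega> assume *: "\<omega> \<in> G \<inter> level (Suc l) b"
    define a where "a = population N l \<omega>"
    define v where "v = restrict (\<lambda>i. N l i \<omega>) {1..a}"
    have sum: "sum v {1..a} = b"
      using * by (simp add: v_def a_def level_def)
    moreover have "v i \<le> b" if "i \<in> {1..a}" for i
      using member_le_sum[of i "{1..a}" v] that sum by simp
    ultimately have "(a, v) \<in> I"
      by (auto simp: I_def PiE_def Pi_def v_def)
    moreover have "\<omega> \<in> A (a, v)"
      using * by (auto simp: A_def level_def cyl_def v_def a_def)
    ultimately show "\<omega> \<in> (\<Union>k\<in>I. A k)" by blast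
  next
    fix \<omega> assume "\<omega> \<in> (\<Union>k\<in>I. A k)"
    then obtain a v where *: "(a, v) \<in> I" "\<omega> \<in> A (a, v)" by auto
    have "(\<Sum>i = 1..a. N l i \<omega>) = sum v {1..a}"
      using *(2) by (intro sum.cong) (auto simp: A_def cyl_def)
    then show "\<omega> \<in> G \<inter> level (Suc l) b"
      using * by (auto simp: A_def level_def I_def)
  qed
  moreover have "past (Suc l) (\<Union>k\<in>I. A k)"
  proof (rule past_UN)
    have "finite {v \<in> {1..a} \<rightarrow>\<^sub>E {..b}. sum v {1..a} = b}" for a :: nat
      by (rule finite_subset[OF _ finite_PiE[of "{1..a}" "\<lambda>_. {..b}"]]) auto
    then show "countable I"
      unfolding I_def by (intro countable_SIGMA) (auto intro: countable_finite)
    show "disjoint_family_on A I"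
      unfolding disjoint_family_on_def
    proof (intro ballI impI)
      fix k k' assume k: "k \<in> I" "k' \<in> I" "k \<noteq> k'"
      show "A k \<inter> A k' = {}"
      proof (rule ccontr)
        assume "A k \<inter> A k' \<noteq> {}"
        then obtain \<omega> where \<omega>: "\<omega> \<in> A k" "\<omega> \<in> A k'" by blast
        obtain a v a' v' where kk: "k = (a, v)" "k' = (a', v')" by (cases k, cases k')
        have "a = a'" using \<omega> by (auto simp: kk A_def level_def)
        moreover have "v = v'"
          using k \<omega> unfolding kk I_def \<open>a = a'\<close>
          by (intro PiE_ext[of v "{1..a'}" _ v']) (auto simp: A_def cyl_def)
        ultimately show False using k kk by simp
      qed
    qed
    show "past (Suc l) (A k)" if "k \<in> I" for k
      unfolding A_def case_prod_beta by (intro past_cyl G) auto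
  qed
  ultimately show ?thesis by simp
qed

lemma past_population: "past l (level l a)"
proof (induction l arbitrary: a)
  case 0
  have "level 0 a = (if a = 1 then space M else {})"
    by (auto simp: level_def)
  then show ?case by (auto simp: past_space past_empty)
next
  case (Suc l)
  have "level l' a \<subseteq> space M" for l' a by (auto simp: level_def)
  then have *: "space M \<inter> level l' a = level l' a" for l' a by auto
  show ?case
    using past_population_Suc[of l "space M" a] Suc by (simp add: *)
qed

lemma measurable_population [measurable]: "population N l \<in> M \<rightarrow>\<^sub>M count_space UNIV"
proof -
  have "population N l -` {a} \<inter> space M = level l a" for a
    by (auto simp: level_def)
  then show ?thesis
    using pastD(1)[OF past_population] by (subst measurable_count_space_eq2_countable) auto
qed

text \<open>Growth after generation \<open>l\<close> is followed one generation at a time while the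
  size at generation \<open>l\<close> stays fixed; this provides the past event for each such
  step.\<close>

lemma past_population_joint: "past (l + k) (level l a \<inter> level (l + k) b)"
proof (induction k arbitrary: b)
  case 0
  have "level l a \<inter> level l b = (if a = b then level l a else {})"
    by (auto simp: level_def)
  then show ?case by (auto simp: past_population past_empty)
next
  case (Suc k)
  then show ?case using past_population_Suc[of "l + k" "level l a" b] by simp
qed

section \<open>Conditional mean growth of the population\<close>

text \<open>An extended-valued counterpart of \<open>offspring_mean\<close>, meaningful also when
  the series diverges.\<close>

definition cond_mean :: "'e \<Rightarrow> ennreal" where
  "cond_mean e = (\<integral>\<^sup>+x. of_nat x \<partial>measure_pmf (p e))"

lemma cond_mean_eq: "cond_mean e = (\<Sum>c. ennreal (pmf (p e) c) * of_nat c)"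
  by (simp add: cond_mean_def nn_integral_measure_pmf nn_integral_count_space_nat)

lemma measurable_cond_mean [measurable]: "cond_mean \<in> borel_measurable E"
  unfolding cond_mean_eq[abs_def] by measurable

text \<open>Write \<open>N l i\<close> as the sum over \<open>c\<close> of \<open>c\<close> times
  the indicator that it equals \<open>c\<close>. Each indicator is a one-point cylinder, replaced by
  its weight through \<open>past\<close>, and the weighted sum is the conditional mean.\<close>

lemma nn_integral_offspring:
  assumes G: "past l G" and i: "i \<ge> 1"
    and f [measurable]: "f \<in> borel_measurable (env_algebra M E \<xi>)"
  shows "(\<integral>\<^sup>+\<omega>. f \<omega> * of_nat (N l i \<omega>) * indicator G \<omega> \<partial>M)
    = (\<integral>\<^sup>+\<omega>. f \<omega> * cond_mean (\<xi> l \<omega>) * indicator G \<omega> \<partial>M)"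
proof -
  have [measurable]: "f \<in> borel_measurable M" "G \<in> sets M" "N l i \<in> M \<rightarrow>\<^sub>M count_space UNIV"
    using measurable_from_subalg[OF subalgebra_env f] pastD(1)[OF G] offspring_measurable[OF i] by auto
  let ?C = "\<lambda>c. cyl {(l, i)} (\<lambda>_ _. c)"
  have [measurable]: "?C c \<in> sets M" for c
    using i by (intro cyl_sets) auto
  have N: "of_nat (N l i \<omega>) = (\<Sum>c. of_nat c * indicator (?C c) \<omega> :: ennreal)" if "\<omega> \<in> space M" for \<omega>
    using that by (subst suminf_finite[of "{N l i \<omega>}"]) (auto simp: cyl_def)
  have "(\<integral>\<^sup>+\<omega>. f \<omega> * of_nat (N l i \<omega>) * indicator G \<omega> \<partial>M)
      = (\<integral>\<^sup>+\<omega>. (\<Sum>c. f \<omega> * of_nat c * indicator (?C c) \<omega> * indicator G \<omega>) \<partial>M)"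
    by (intro nn_integral_cong) (simp only: N ennreal_suminf_cmult ennreal_suminf_multc mult.assoc[of "f _"])
  also have "\<dots> = (\<Sum>c. \<integral>\<^sup>+\<omega>. f \<omega> * of_nat c * indicator (?C c) \<omega> * indicator G \<omega> \<partial>M)"
    by (intro nn_integral_suminf) measurable
  also have "\<dots> = (\<Sum>c. \<integral>\<^sup>+\<omega>. f \<omega> * of_nat c * weight {(l, i)} (\<lambda>_ _. c) \<omega> * indicator G \<omega> \<partial>M)"
    using i by (intro arg_cong[where f = suminf] ext pastD(2)[OF G]) auto
  also have "\<dots> = (\<integral>\<^sup>+\<omega>. (\<Sum>c. f \<omega> * of_nat c * weight {(l, i)} (\<lambda>_ _. c) \<omega> * indicator G \<omega>) \<partial>M)"
    unfolding weight_def by (intro nn_integral_suminf[symmetric]) simp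
  also have "\<dots> = (\<integral>\<^sup>+\<omega>. f \<omega> * cond_mean (\<xi> l \<omega>) * indicator G \<omega> \<partial>M)"
    by (simp add: weight_def cond_mean_eq mult_ac flip: ennreal_suminf_cmult ennreal_suminf_multc)
  finally show ?thesis .
qed

lemma nn_integral_levels:
  assumes [measurable]: "h \<in> borel_measurable M"
  shows "(\<integral>\<^sup>+\<omega>. h \<omega> \<partial>M) = (\<Sum>b. \<integral>\<^sup>+\<omega>. h \<omega> * indicator (level l b) \<omega> \<partial>M)"
proof -
  have [measurable]: "level l b \<in> sets M" for b
    by (rule pastD(1)[OF past_population])
  have "h \<omega> = (\<Sum>b. h \<omega> * indicator (level l b) \<omega>)" if "\<omega> \<in> space M" for \<omega>
    using that by (subst suminf_finite[of "{population N l \<omega>}"]) (auto simp: level_def)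
  then have "(\<integral>\<^sup>+\<omega>. h \<omega> \<partial>M) = (\<integral>\<^sup>+\<omega>. (\<Sum>b. h \<omega> * indicator (level l b) \<omega>) \<partial>M)"
    by (intro nn_integral_cong)
  also have "\<dots> = (\<Sum>b. \<integral>\<^sup>+\<omega>. h \<omega> * indicator (level l b) \<omega> \<partial>M)"
    by (intro nn_integral_suminf) measurable
  finally show ?thesis .
qed

text \<open>On \<open>level l b\<close> the random sum has the fixed number \<open>b\<close> of
  terms, each contributing the same conditional mean; summing over \<open>b\<close> restores the
  random size.\<close>

lemma nn_integral_population_Suc:
  assumes f [measurable]: "f \<in> borel_measurable (env_algebra M E \<xi>)"
    and G: "\<And>b. past l (G \<inter> level l b)" and GM: "G \<in> sets M"
  shows "(\<integral>\<^sup>+\<omega>. f \<omega> * of_nat (population N (Suc l) \<omega>) * indicator G \<omega> \<partial>M)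
    = (\<integral>\<^sup>+\<omega>. f \<omega> * cond_mean (\<xi> l \<omega>) * of_nat (population N l \<omega>) * indicator G \<omega> \<partial>M)"
proof -
  note [measurable] = measurable_from_subalg[OF subalgebra_env f] GM pastD(1)[OF G]
  have "(\<integral>\<^sup>+\<omega>. f \<omega> * of_nat (population N (Suc l) \<omega>) * indicator G \<omega> * indicator (level l b) \<omega> \<partial>M)
    = (\<integral>\<^sup>+\<omega>. f \<omega> * cond_mean (\<xi> l \<omega>) * of_nat (population N l \<omega>) * indicator G \<omega> * indicator (level l b) \<omega> \<partial>M)" for b
  proof -
    have [measurable]: "N l i \<in> M \<rightarrow>\<^sub>M count_space UNIV" if "i \<in> {1..b}" for i
      using that by (intro offspring_measurable) auto
    have "(\<integral>\<^sup>+\<omega>. f \<omega> * of_nat (population N (Suc l) \<omega>) * indicator G \<omega> * indicator (level l b) \<omega> \<partial>M)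
      = (\<integral>\<^sup>+\<omega>. (\<Sum>i = 1..b. f \<omega> * of_nat (N l i \<omega>) * indicator (G \<inter> level l b) \<omega>) \<partial>M)"
      by (intro nn_integral_cong) (auto simp: level_def indicator_def sum_distrib_left)
    also have "\<dots> = (\<Sum>i = 1..b. \<integral>\<^sup>+\<omega>. f \<omega> * of_nat (N l i \<omega>) * indicator (G \<inter> level l b) \<omega> \<partial>M)"
      by (intro nn_integral_sum) measurable
    also have "\<dots> = (\<Sum>i = 1..b. \<integral>\<^sup>+\<omega>. f \<omega> * cond_mean (\<xi> l \<omega>) * indicator (G \<inter> level l b) \<omega> \<partial>M)"
      by (intro sum.cong nn_integral_offspring G f) auto
    also have "\<dots> = (\<integral>\<^sup>+\<omega>. of_nat b * (f \<omega> * cond_mean (\<xi> l \<omega>) * indicator (G \<inter> level l b) \<omega>) \<partial>M)"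
      by (subst nn_integral_cmult) auto
    also have "\<dots> = (\<integral>\<^sup>+\<omega>. f \<omega> * cond_mean (\<xi> l \<omega>) * of_nat (population N l \<omega>) * indicator G \<omega> * indicator (level l b) \<omega> \<partial>M)"
      by (intro nn_integral_cong) (auto simp: level_def indicator_def mult_ac)
    finally show ?thesis .
  qed
  then show ?thesis
    by (subst (1 2) nn_integral_levels[where l = l]) (auto simp del: population.simps)
qed

text \<open>Generations are peeled off from the last one. The induction is over all
  \<open>f\<close>, because the conditional mean of the peeled generation is environment-measurable
  and joins \<open>f\<close>.\<close>

lemma nn_integral_population:
  assumes f: "f \<in> borel_measurable (env_algebra M E \<xi>)"
  shows "(\<integral>\<^sup>+\<omega>. f \<omega> * of_nat (population N (l + k) \<omega>) * indicator (level l a) \<omega> \<partial>M)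
    = (\<integral>\<^sup>+\<omega>. f \<omega> * (\<Prod>j\<in>{l..<l + k}. cond_mean (\<xi> j \<omega>)) * of_nat a * indicator (level l a) \<omega> \<partial>M)"
  using f
proof (induction k arbitrary: f)
  case 0
  show ?case by (intro nn_integral_cong) (auto simp: level_def indicator_def)
next
  case (Suc k)
  note [measurable] = Suc.prems
  have "(\<integral>\<^sup>+\<omega>. f \<omega> * of_nat (population N (l + Suc k) \<omega>) * indicator (level l a) \<omega> \<partial>M)
      = (\<integral>\<^sup>+\<omega>. f \<omega> * cond_mean (\<xi> (l + k) \<omega>) * of_nat (population N (l + k) \<omega>) * indicator (level l a) \<omega> \<partial>M)"
    using nn_integral_population_Suc[OF Suc.prems past_population_joint pastD(1)[OF past_population], of l k a]
    by simp
  also have "\<dots> = (\<integral>\<^sup>+\<omega>. f \<omega> * cond_mean (\<xi> (l + k) \<omega>) * (\<Prod>j\<in>{l..<l + k}. cond_mean (\<xi> j \<omega>)) * of_nat a * indicator (level l a) \<omega> \<partial>M)"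
    by (rule Suc.IH) measurable
  finally show ?case by (simp add: mult_ac)
qed

text \<open>The product is 1 except at 0 and infinity, where it is 0 by the conventions of
  \<open>ennreal\<close>; hence an inequality only.\<close>

lemma ennreal_inverse_mult_le: "inverse x * x \<le> (1 :: ennreal)"
  by (cases "x = 0"; cases "x = \<top>") (auto simp: ennreal_divide_self less_top mult.commute[of _ x] simp flip: divide_ennreal_def)

text \<open>On \<open>level l a\<close> the normalizing factors are environment-measurable, so
  \<open>nn_integral_population\<close> applies and they cancel up to an inequality. Each level then
  contributes at most its probability.\<close>

lemma nn_integral_normalized_population_le:
  "(\<integral>\<^sup>+\<omega>. inverse (\<Prod>j\<in>{l..<l + k}. cond_mean (\<xi> j \<omega>)) * of_nat (population N (l + k) \<omega>)
      * inverse (of_nat (population N l \<omega>)) \<partial>M) \<le> 1"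
proof -
  let ?P = "\<lambda>\<omega>. \<Prod>j\<in>{l..<l + k}. cond_mean (\<xi> j \<omega>)"
  let ?h = "\<lambda>\<omega>. inverse (?P \<omega>) * of_nat (population N (l + k) \<omega>) * inverse (of_nat (population N l \<omega>)) :: ennreal"
  have [measurable]: "level l b \<in> sets M" for b
    by (rule pastD(1)[OF past_population])
  have "(\<integral>\<^sup>+\<omega>. ?h \<omega> * indicator (level l a) \<omega> \<partial>M) \<le> (\<integral>\<^sup>+\<omega>. 1 * indicator (level l a) \<omega> \<partial>M)" for a
  proof -
    have "(\<integral>\<^sup>+\<omega>. ?h \<omega> * indicator (level l a) \<omega> \<partial>M)
        = (\<integral>\<^sup>+\<omega>. (inverse (?P \<omega>) * inverse (of_nat a)) * of_nat (population N (l + k) \<omega>) * indicator (level l a) \<omega> \<partial>M)"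
      by (intro nn_integral_cong) (auto simp: level_def indicator_def mult_ac)
    also have "\<dots> = (\<integral>\<^sup>+\<omega>. (inverse (?P \<omega>) * inverse (of_nat a)) * ?P \<omega> * of_nat a * indicator (level l a) \<omega> \<partial>M)"
      by (rule nn_integral_population) measurable
    also have "\<dots> = (\<integral>\<^sup>+\<omega>. (inverse (?P \<omega>) * ?P \<omega>) * (inverse (of_nat a) * of_nat a) * indicator (level l a) \<omega> \<partial>M)"
      by (simp only: mult_ac)
    also have "\<dots> \<le> (\<integral>\<^sup>+\<omega>. 1 * indicator (level l a) \<omega> \<partial>M)"
      by (intro nn_integral_mono mult_right_mono mult_le_one ennreal_inverse_mult_le) auto
    finally show ?thesis .
  qed
  then have "(\<integral>\<^sup>+\<omega>. ?h \<omega> \<partial>M) \<le> (\<integral>\<^sup>+\<omega>. 1 \<partial>M)"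
    by (subst (1 2) nn_integral_levels[where l = l]) (auto intro!: suminf_le)
  then show ?thesis by (simp add: emeasure_space_1)
qed


section \<open>Almost sure properties of the means and of the population\<close>

lemma cond_mean_eq_offspring_mean:
  assumes "summable (\<lambda>i. real i * pmf (p e) i)"
  shows "cond_mean e = ennreal (offspring_mean (p e))"
proof -
  have "cond_mean e = (\<Sum>i. ennreal (real i * pmf (p e) i))"
    by (simp add: cond_mean_eq ennreal_mult mult.commute flip: ennreal_of_nat_eq_real_of_nat)
  also have "\<dots> = ennreal (offspring_mean (p e))"
    unfolding offspring_mean_def using assms by (intro suminf_ennreal2) auto
  finally show ?thesis .
qed

lemma cond_mean_ge_1:
  assumes "pmf (p e) 0 = 0"
  shows "1 \<le> cond_mean e"
proof -
  have "AE x in measure_pmf (p e). (1 :: ennreal) \<le> of_nat x"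
    using assms by (auto simp: AE_measure_pmf_iff set_pmf_iff Suc_le_eq intro!: gr0I)
  then have "(\<integral>\<^sup>+x. 1 \<partial>measure_pmf (p e)) \<le> cond_mean e"
    unfolding cond_mean_def by (rule nn_integral_mono_AE)
  then show ?thesis by simp
qed

text \<open>Whether \<open>P\<close> holds almost surely depends only on the law of
  \<open>\<xi> n\<close>, which is the same for every \<open>n\<close>.\<close>

lemma AE_env_shift:
  assumes "{e \<in> space E. P e} \<in> sets E" and "AE \<omega> in M. P (\<xi> 0 \<omega>)"
  shows "AE \<omega> in M. P (\<xi> n \<omega>)"
proof -
  have "(AE e in distr M E (\<xi> n). P e) \<longleftrightarrow> (AE \<omega> in M. P (\<xi> n \<omega>))" for n
    using assms(1) by (intro AE_distr_iff env_random_variable)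
  then show ?thesis
    using assms(2) by (metis env_ident)
qed

text \<open>The hypothesis speaks of the conditional law. It makes the weight of a childless
  individual vanish almost surely, so each event \<open>N n i = 0\<close> is null, and there are
  countably many.\<close>

lemma AE_population_ge_1:
  assumes "AE \<omega> in M. pmf (p (\<xi> 0 \<omega>)) 0 = 0"
  shows "AE \<omega> in M. \<forall>l. 1 \<le> population N l \<omega>"
proof -
  have *: "AE \<omega> in M. 1 \<le> i \<longrightarrow> N n i \<omega> \<noteq> 0" for n i
  proof (cases "1 \<le> i")
    case True
    let ?C = "cyl {(n, i)} (\<lambda>_ _. 0)"
    have [measurable]: "?C \<in> sets M"
      using True by (intro cyl_sets) auto
    have "AE \<omega> in M. pmf (p (\<xi> n \<omega>)) 0 = 0"
      by (rule AE_env_shift[OF _ assms]) measurable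
    then have "(\<integral>\<^sup>+\<omega>. 1 * weight {(n, i)} (\<lambda>_ _. 0) \<omega> \<partial>M) = (\<integral>\<^sup>+\<omega>. 0 \<partial>M)"
      by (intro nn_integral_cong_AE) (auto simp: weight_def)
    moreover have "(\<integral>\<^sup>+\<omega>. 1 * indicator ?C \<omega> \<partial>M) = (\<integral>\<^sup>+\<omega>. 1 * weight {(n, i)} (\<lambda>_ _. 0) \<omega> \<partial>M)"
      using True by (intro nn_integral_cyl) auto
    ultimately have "emeasure M ?C = 0"
      by simp
    then have "AE \<omega> in M. \<omega> \<notin> ?C"
      by (intro AE_not_in) (auto simp: null_sets_def)
    then show ?thesis
      using AE_space by eventually_elim (auto simp: cyl_def)
  qed simp
  have "AE \<omega> in M. \<forall>n i. 1 \<le> i \<longrightarrow> N n i \<omega> \<noteq> 0"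
    unfolding AE_all_countable using * by blast
  then show ?thesis
  proof eventually_elim
    case (elim \<omega>)
    have "1 \<le> population N l \<omega>" for l
    proof (induction l)
      case (Suc l)
      \<comment> \<open>Individual 1 exists in generation \<open>l\<close> by the induction
        hypothesis, and its children alone keep the population positive.\<close>
      have "N l 1 \<omega> \<le> population N (Suc l) \<omega>"
        using Suc by (auto intro: member_le_sum)
      moreover have "N l 1 \<omega> \<noteq> 0"
        using elim by simp
      ultimately show ?case by linarith
    qed simp
    then show ?case by blast
  qed
qed

section \<open>The two tail bounds\<close>

abbreviation log_mean :: "nat \<Rightarrow> 'a \<Rightarrow> real" where
  "log_mean j \<omega> \<equiv> ln (offspring_mean (p (\<xi> j \<omega>)))"

text \<open>Markov's inequality for the normalized population: up to a null set, the event forces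
  the ratio in \<open>nn_integral_normalized_population_le\<close> to be at least
  \<open>exp c\<close>.\<close>

lemma prob_population_growth_ge:
  fixes c :: real
  assumes nz: "AE \<omega> in M. pmf (p (\<xi> 0 \<omega>)) 0 = 0"
    and fin: "AE \<omega> in M. summable (\<lambda>i. real i * pmf (p (\<xi> 0 \<omega>)) i)"
  shows "prob {\<omega> \<in> space M. real (population N l \<omega>) * exp ((\<Sum>j\<in>{l..<l + k}. log_mean j \<omega>) + c)
      \<le> real (population N (l + k) \<omega>)} \<le> exp (- c)"
proof -
  let ?h = "\<lambda>\<omega>. inverse (\<Prod>j\<in>{l..<l + k}. cond_mean (\<xi> j \<omega>)) * of_nat (population N (l + k) \<omega>)
      * inverse (of_nat (population N l \<omega>)) :: ennreal"
  let ?B = "{\<omega> \<in> space M. real (population N l \<omega>) * exp ((\<Sum>j\<in>{l..<l + k}. log_mean j \<omega>) + c)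
      \<le> real (population N (l + k) \<omega>)}"
  have "AE \<omega> in M. cond_mean (\<xi> 0 \<omega>) = ennreal (offspring_mean (p (\<xi> 0 \<omega>))) \<and> 1 \<le> cond_mean (\<xi> 0 \<omega>)"
    using nz fin by eventually_elim (intro conjI cond_mean_ge_1 cond_mean_eq_offspring_mean)
  from AE_env_shift[OF _ this]
  have "AE \<omega> in M. cond_mean (\<xi> j \<omega>) = ennreal (offspring_mean (p (\<xi> j \<omega>))) \<and> 1 \<le> cond_mean (\<xi> j \<omega>)" for j
    by measurable
  then have "AE \<omega> in M. \<forall>j. cond_mean (\<xi> j \<omega>) = ennreal (offspring_mean (p (\<xi> j \<omega>))) \<and> 1 \<le> cond_mean (\<xi> j \<omega>)"
    unfolding AE_all_countable by blast
  with AE_population_ge_1[OF nz]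
  have "AE \<omega> in M. \<omega> \<in> ?B \<longrightarrow> \<omega> \<in> {\<omega> \<in> space M. 1 \<le> ennreal (exp (- c)) * ?h \<omega>}"
  proof eventually_elim
    case (elim \<omega>)
    define m where "m j = offspring_mean (p (\<xi> j \<omega>))" for j
    define Z where "Z j = real (population N j \<omega>)" for j
    have m: "cond_mean (\<xi> j \<omega>) = ennreal (m j)" for j
      using elim(2) by (simp add: m_def)
    then have "1 \<le> ennreal (m j)" for j
      using elim(2) by metis
    \<comment> \<open>Since \<open>ennreal\<close> truncates negative numbers to 0, the lower bound
      1 forces \<open>m j\<close> to be positive. This makes \<open>exp\<close> undo the logarithm
      and the \<open>ennreal\<close> inverses real.\<close>
    then have m0: "0 < m j" for j
      by (metis ennreal_eq_0_iff linorder_not_less not_one_le_zero)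
    have Z: "0 < Z j" for j
      using elim(1) by (simp add: Z_def Suc_le_eq)
    let ?P = "\<Prod>j\<in>{l..<l + k}. m j"
    have P: "0 < ?P"
      by (intro prod_pos) (simp add: m0)
    have "(\<Prod>j\<in>{l..<l + k}. cond_mean (\<xi> j \<omega>)) = ennreal ?P"
      using m0 by (simp add: m prod_ennreal less_imp_le)
    then have "?h \<omega> = inverse (ennreal ?P) * ennreal (Z (l + k)) * inverse (ennreal (Z l))"
      by (simp add: Z_def ennreal_of_nat_eq_real_of_nat)
    also have "\<dots> = ennreal (inverse ?P * Z (l + k) * inverse (Z l))"
      using P Z[of l] Z[of "l + k"] by (simp add: inverse_ennreal ennreal_mult less_imp_le)
    finally have h: "?h \<omega> = ennreal (inverse ?P * Z (l + k) * inverse (Z l))" .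
    have "1 \<le> exp (- c) * (inverse ?P * Z (l + k) * inverse (Z l))" if "\<omega> \<in> ?B"
    proof -
      have "exp (\<Sum>j\<in>{l..<l + k}. log_mean j \<omega>) = ?P"
        using m0 by (simp add: exp_sum m_def)
      then have "Z l * (?P * exp c) \<le> Z (l + k)"
        using that by (simp add: exp_add Z_def)
      then show ?thesis
        using P Z[of l] by (simp add: exp_minus field_simps)
    qed
    then show ?case
      by (auto simp: h simp flip: ennreal_mult' ennreal_1)
  qed
  then have "emeasure M ?B \<le> emeasure M {\<omega> \<in> space M. 1 \<le> ennreal (exp (- c)) * ?h \<omega>}"
    by (intro emeasure_mono_AE) auto
  also have "\<dots> \<le> ennreal (exp (- c)) * (\<integral>\<^sup>+\<omega>. ?h \<omega> * indicator (space M) \<omega> \<partial>M)"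
    by (intro nn_integral_Markov_inequality) auto
  also have "(\<integral>\<^sup>+\<omega>. ?h \<omega> * indicator (space M) \<omega> \<partial>M) = (\<integral>\<^sup>+\<omega>. ?h \<omega> \<partial>M)"
    by (intro nn_integral_cong) auto
  also have "ennreal (exp (- c)) * \<dots> \<le> ennreal (exp (- c)) * 1"
    by (intro mult_left_mono nn_integral_normalized_population_le) auto
  finally show ?thesis
    by (simp add: emeasure_eq_measure)
qed

text \<open>Hoeffding's inequality: the log means are functions of the independent coordinates
  \<open>\<xi> j\<close>, and equality in law carries the bounds and the mean from generation 0 to
  every \<open>j\<close>.\<close>

lemma prob_log_mean_sum_ge:
  fixes \<epsilon> H1 H2 :: real
  assumes H: "H1 < H2" and k: "k \<ge> 1" and \<epsilon>: "\<epsilon> \<ge> 0"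
    and bound: "AE \<omega> in M. log_mean 0 \<omega> \<in> {\<mu> + H1..\<mu> + H2}"
    and mu: "\<mu> = expectation (log_mean 0)"
  shows "prob {\<omega> \<in> space M. real k * \<mu> + \<epsilon> \<le> (\<Sum>j\<in>{l..<l + k}. log_mean j \<omega>)}
    \<le> exp (- 2 * \<epsilon>\<^sup>2 / (real k * (H2 - H1)\<^sup>2))"
proof -
  have "indep_vars (\<lambda>_. borel) log_mean UNIV"
    by (rule indep_vars_compose2[OF env_indep]) measurable
  then have indep: "indep_vars (\<lambda>_. borel) log_mean {l..<l + k}"
    by (rule indep_vars_subset) simp
  have AE: "AE \<omega> in M. log_mean j \<omega> \<in> {\<mu> + H1..\<mu> + H2}" for j
    by (rule AE_env_shift[OF _ bound]) measurable
  have expectation: "expectation (log_mean j) = \<mu>" for j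
  proof -
    have "expectation (log_mean j) = (\<integral>e. ln (offspring_mean (p e)) \<partial>distr M E (\<xi> j))" for j
      by (intro integral_distr[symmetric]) measurable
    then show ?thesis by (simp only: env_ident[of j] mu)
  qed
  interpret H: Hoeffding_ineq M "{l..<l + k}" log_mean "\<lambda>_. \<mu> + H1" "\<lambda>_. \<mu> + H2" "real k * \<mu>"
    using indep AE by unfold_locales (auto simp: expectation)
  show ?thesis
    \<comment> \<open>All \<open>k\<close> intervals have width \<open>H2 - H1\<close>, so the
      squared widths sum to \<open>k * (H2 - H1)^2\<close>, which is positive by \<open>H\<close>
      and \<open>k\<close>.\<close>
    using H.Hoeffding_ineq_ge[OF \<epsilon>] H k by simp
qed

end

section \<open>Calibration of the two deviations and the union bound\<close>

theorem proposition3p4: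
  fixes M :: "'a measure" and E :: "'e measure"
    and \<xi> :: "nat \<Rightarrow> 'a \<Rightarrow> 'e"
    and p :: "'e \<Rightarrow> nat pmf"
    and N :: "nat \<Rightarrow> nat \<Rightarrow> 'a \<Rightarrow> nat"
    and X :: "'a \<Rightarrow> real"
    and Z :: "nat \<Rightarrow> 'a \<Rightarrow> nat"
    and A :: "'a \<Rightarrow> real"
    and \<mu> H1 H2 \<delta> \<Delta> :: real
    and n0 n :: nat
  assumes bpre: "bpre M E \<xi> p N"
    and Z: "Z = population N"
    and X: "X = (\<lambda>\<omega>. ln (offspring_mean (p (\<xi> 0 \<omega>))))"
    and mu: "\<mu> = prob_space.expectation M X"
    and at_least_one_child: "AE \<omega> in M. pmf (p (\<xi> 0 \<omega>)) 0 = 0"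
    and finite_mean: "AE \<omega> in M. summable (\<lambda>i. real i * pmf (p (\<xi> 0 \<omega>)) i)"
    and X_integrable: "integrable M X"
    and variance_finite: "integrable M (\<lambda>\<omega>. (X \<omega> - \<mu>)\<^sup>2)"
    and variance_pos: "prob_space.expectation M (\<lambda>\<omega>. (X \<omega> - \<mu>)\<^sup>2) > 0"
    and H: "H1 < H2"
    and X_bounded: "AE \<omega> in M. H1 \<le> X \<omega> - \<mu> \<and> X \<omega> - \<mu> \<le> H2"
    and n: "n \<ge> 1"
    and delta: "\<delta> \<in> {2 * exp (- (real n / 2) * (H2 - H1)\<^sup>2) .. 1}"
    and Delta: "\<Delta> = (H2 - H1) * sqrt (2 / real n * ln (2 / \<delta>))"
    and A: "A = (\<lambda>\<omega>. real (Z n0 \<omega>) * exp (real n * (\<mu> + \<Delta>)))"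
  shows "prob_space.prob M {\<omega> \<in> space M. 1 \<le> Z (n0 + n) \<omega> \<and> real (Z (n0 + n) \<omega>) \<le> A \<omega>} \<ge> 1 - \<delta>"
proof -
  interpret bpre M E \<xi> p N by (rule bpre)
  \<comment> \<open>Each tail is to have probability at most \<open>exp (- L)\<close>, which is
    \<open>\<delta> / 2\<close>; the total deviation \<open>n * \<Delta>\<close> is shared equally,
    \<open>c\<close> for each tail.\<close>
  define L where "L = ln (2 / \<delta>)"
  define c where "c = real n * \<Delta> / 2"
  have "0 < 2 * exp (- (real n / 2) * (H2 - H1)\<^sup>2)"
    by simp
  also have "\<dots> \<le> \<delta>"
    using delta by simp
  finally have \<delta>: "0 < \<delta>" .
  have expL: "exp (- L) = \<delta> / 2"
    using \<delta> by (simp add: L_def exp_minus)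
  have L0: "0 \<le> L"
    using \<delta> delta by (simp add: L_def)
  \<comment> \<open>The lower bound on \<open>\<delta>\<close>, in logarithmic form, caps
    \<open>L\<close>.\<close>
  have "ln (2 * exp (- (real n / 2) * (H2 - H1)\<^sup>2) / 2) \<le> ln (\<delta> / 2)"
    using \<delta> delta by (intro ln_mono) auto
  then have L_le: "L \<le> real n / 2 * (H2 - H1)\<^sup>2"
    using \<delta> by (simp add: L_def ln_div)
  have c_sq: "c\<^sup>2 = real n * (H2 - H1)\<^sup>2 / 2 * L"
    using n L0 by (simp add: c_def Delta L_def[symmetric] power_mult_distrib power_divide power2_eq_square[of "real n"])
  have c0: "0 \<le> c"
    using H L0 by (simp add: c_def Delta L_def[symmetric])
  \<comment> \<open>Multiplying the cap on \<open>L\<close> by \<open>L\<close> gives exactly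
    \<open>c_sq\<close> on the right. The resulting \<open>L \<le> c\<close> brings the Markov bound
    \<open>exp (- c)\<close> below \<open>\<delta> / 2\<close>.\<close>
  have "L\<^sup>2 \<le> c\<^sup>2"
    using mult_right_mono[OF L_le L0] by (simp only: c_sq power2_eq_square[of L] mult_ac times_divide_eq_left times_divide_eq_right)
  then have "L \<le> c"
    using c0 by (rule power2_le_imp_le)
  let ?B1 = "{\<omega> \<in> space M. real (Z n0 \<omega>) * exp ((\<Sum>j\<in>{n0..<n0 + n}. log_mean j \<omega>) + c) \<le> real (Z (n0 + n) \<omega>)}"
  let ?B2 = "{\<omega> \<in> space M. real n * \<mu> + c \<le> (\<Sum>j\<in>{n0..<n0 + n}. log_mean j \<omega>)}"
  let ?G = "{\<omega> \<in> space M. 1 \<le> Z (n0 + n) \<omega> \<and> real (Z (n0 + n) \<omega>) \<le> A \<omega>}"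
  have [measurable]: "?B1 \<in> events"
    unfolding Z by measurable
  have [measurable]: "?B2 \<in> events"
    by measurable
  have "{\<omega> \<in> space M. 1 \<le> real (Z (n0 + n) \<omega>) \<and> real (Z (n0 + n) \<omega>) \<le> A \<omega>} \<in> events"
    unfolding A Z by (intro sets.sets_Collect_conj borel_measurable_le) measurable
  then have G: "?G \<in> events"
    by (simp only: of_nat_le_iff flip: of_nat_1[where 'a = real])
  have "prob ?B1 \<le> exp (- c)"
    unfolding Z by (rule prob_population_growth_ge[OF at_least_one_child finite_mean])
  also have "\<dots> \<le> \<delta> / 2"
    using \<open>L \<le> c\<close> by (simp flip: expL)
  finally have B1: "prob ?B1 \<le> \<delta> / 2" .
  have "prob ?B2 \<le> exp (- 2 * c\<^sup>2 / (real n * (H2 - H1)\<^sup>2))"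
  proof (rule prob_log_mean_sum_ge[OF H n c0])
    show "AE \<omega> in M. log_mean 0 \<omega> \<in> {\<mu> + H1..\<mu> + H2}"
      using X_bounded by eventually_elim (auto simp: X)
    show "\<mu> = expectation (log_mean 0)"
      by (simp add: mu X)
  qed
  \<comment> \<open>The factor \<open>sqrt (2 / n * L)\<close> in \<open>\<Delta>\<close> is chosen
    so that the Hoeffding exponent is exactly \<open>- L\<close>.\<close>
  also have "- 2 * c\<^sup>2 / (real n * (H2 - H1)\<^sup>2) = - L"
    using n H by (simp add: c_sq)
  finally have B2: "prob ?B2 \<le> \<delta> / 2"
    by (simp add: expL)
  have "prob (space M - (?B1 \<union> ?B2)) \<le> prob ?G"
  \<comment> \<open>The inclusion holds only almost everywhere, because the lower endpoint 1 is an
    almost sure bound.\<close>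
  proof (rule finite_measure_mono_AE)
    show "AE \<omega> in M. \<omega> \<in> space M - (?B1 \<union> ?B2) \<longrightarrow> \<omega> \<in> ?G"
      using AE_population_ge_1[OF at_least_one_child]
    proof eventually_elim
      case (elim \<omega>)
      show ?case
      proof
        assume \<omega>: "\<omega> \<in> space M - (?B1 \<union> ?B2)"
        \<comment> \<open>Outside \<open>?B2\<close> the sum is below \<open>n * \<mu> + c\<close>,
          and the second \<open>c\<close> completes \<open>n * \<Delta>\<close>.\<close>
        then have "(\<Sum>j\<in>{n0..<n0 + n}. log_mean j \<omega>) + c \<le> real n * (\<mu> + \<Delta>)"
          by (auto simp: c_def field_simps)
        then have "real (Z n0 \<omega>) * exp ((\<Sum>j\<in>{n0..<n0 + n}. log_mean j \<omega>) + c) \<le> A \<omega>"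
          unfolding A by (intro mult_left_mono) auto
        moreover have "real (Z (n0 + n) \<omega>) < real (Z n0 \<omega>) * exp ((\<Sum>j\<in>{n0..<n0 + n}. log_mean j \<omega>) + c)"
          using \<omega> by auto
        ultimately show "\<omega> \<in> ?G"
          using \<omega> elim by (auto simp: Z)
      qed
    qed
  qed (rule G)
  moreover have "prob (space M - (?B1 \<union> ?B2)) = 1 - prob (?B1 \<union> ?B2)"
    by (rule prob_compl) simp
  moreover have "prob (?B1 \<union> ?B2) \<le> prob ?B1 + prob ?B2"
    by (rule measure_Un_le) auto
  ultimately show ?thesis
    using B1 B2 by linarith
qed

end
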